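(* Let $f,g,c$ satisfy the standing assumption on the composite problem (P), $\min_x\Phi(x)=f(x)+g(c(x))$, and suppose that (P) possesses a stationary minimizer. Let $\{(x^k,z^k,y^k)\}$ be a sequence generated by the classical augmented Lagrangian method (described in the context) such that $\sum_{k=0}^\infty\sqrt{\varepsilon_k/\mu_k}<\infty$. Then $\{y^k\}$ converges to some vector in $\Lambda$, and $c(x^k)-z^k\to0$ and $$\limsup_{k\to\infty}\left(f(x^k)+g(z^k)\right)\le\Phi^\star .$$ Particularly, each accumulation point $\bar x\in\mathbb R^n$ of $\{x^k\}$ is a minimizer of (P). For each subsequence $\{x^k\}_{k\in K}$ ($K\subseteq\mathbb N$ infinite) converging to some $\bar x$, one has $z^k\to c(\bar x)$ and $f(x^k)+g(z^k)\to\Phi^\star$ as $k\to\infty$, $k\in K$.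
   Context: Spaces $\mathbb R^n,\mathbb R^m$ carry the Euclidean inner product $\langle\cdot,\cdot\rangle$ and norm $\|\cdot\|$; $\overline{\mathbb R}=\mathbb R\cup\{+\infty\}$. For a proper lsc convex $g:\mathbb R^m\to\overline{\mathbb R}$, the horizon is $\operatorname{hzn} g=\{v\in\mathbb R^m : g(z+v)\le g(z)\ \forall z\in\operatorname{dom} g\}$. Standing assumption: $f:\mathbb R^n\to\mathbb R$ is continuously differentiable and convex; $g:\mathbb R^m\to\overline{\mathbb R}$ is proper, lsc, convex; $c:\mathbb R^n\to\mathbb R^m$ is continuously differentiable and $(-\operatorname{hzn} g)$-convex, i.e. $c(\lambda x+(1-\lambda)x')-\lambda c(x)-(1-\lambda)c(x')\in\operatorname{hzn} g$ for all $x,x'\in\mathbb R^n$, $\lambda\in[0,1]$; (P) is feasible and possesses a minimizer, with minimal value $\Phi^\star$. A feasible point $\bar x$ is stationary if there is $\bar y\in\partial g(c(\bar x))$ with $\nabla f(\bar x)+c'(\bar x)^\top\bar y=0$; the set of all such $\bar y$ (multipliers) is $\Lambda(\bar x)$. If (P) has a stationary minimizer, all minimizers of (P) are stationary and share the same multiplier set, denoted $\Lambda$. For $\mu>0$ the augmented Lagrangian is $L_\mu(x,y)=f(x)+g^\mu(c(x)+\mu y)-\frac\mu2\|y\|^2$, where $g^\mu(z)=\inf_w\{g(w)+\frac1{2\mu}\|w-z\|^2\}$. $\operatorname{prox}_\varphi(z)$ is the unique minimizer of $w\mapsto\varphi(w)+\frac12\|w-z\|^2$. Classical ALM. Data: $\mu_0>0$;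 $y^0\in\mathbb R^m$; $\beta\in(0,1)$. For $k=0,1,2,\dots$: select $\varepsilon_k\ge0$ and $x^k\in\mathbb R^n$ with $L_{\mu_k}(x^k,y^k)\le\inf_xL_{\mu_k}(x,y^k)+\varepsilon_k$; set $z^k=\operatorname{prox}_{\mu_kg}(c(x^k)+\mu_ky^k)$; set $y^{k+1}=y^k+\mu_k^{-1}(c(x^k)-z^k)$; set $\mu_{k+1}=\beta_k\mu_k$ for some $\beta_k\in(0,\beta]\cup\{1\}$. *)

theory Defs
  imports "HOL-Analysis.Analysis"
begin

section \<open>Extended-real-valued convex functions\<close>

definition eff_dom :: "('a \<Rightarrow> ereal) \<Rightarrow> 'a set" where
  "eff_dom g = {z. g z < \<infinity>}"

text \<open>The type \<^typ>\<open>ereal\<close> also contains minus infinity; properness excludes that value.\<close>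

definition proper_fun :: "('a \<Rightarrow> ereal) \<Rightarrow> bool" where
  "proper_fun g \<longleftrightarrow> (\<forall>z. g z \<noteq> - \<infinity>) \<and> eff_dom g \<noteq> {}"

definition lsc_fun :: "('a::topological_space \<Rightarrow> ereal) \<Rightarrow> bool" where
  "lsc_fun g \<longleftrightarrow> (\<forall>z. g z \<le> Liminf (at z) g)"

text \<open>In \<^typ>\<open>ereal\<close> we have \<open>0 * \<infinity> = 0\<close>, so the endpoints \<open>t = 0\<close> and \<open>t = 1\<close> are harmless; used
  only for functions that never take the value minus infinity.\<close>

definition convex_fun :: "('a::real_vector \<Rightarrow> ereal) \<Rightarrow> bool" where
  "convex_fun g \<longleftrightarrow> (\<forall>z w. \<forall>t\<in>{0..1}.
     g (t *\<^sub>R z + (1 - t) *\<^sub>R w) \<le> ereal t * g z + ereal (1 - t) * g w)"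

definition hzn :: "('a::real_vector \<Rightarrow> ereal) \<Rightarrow> 'a set" where
  "hzn g = {v. \<forall>z\<in>eff_dom g. g (z + v) \<le> g z}"

definition subdiff :: "('a::real_inner \<Rightarrow> ereal) \<Rightarrow> 'a \<Rightarrow> 'a set" where
  "subdiff g z = {y. z \<in> eff_dom g \<and> (\<forall>w. g z + ereal (y \<bullet> (w - z)) \<le> g w)}"

definition moreau_env :: "real \<Rightarrow> ('a::real_inner \<Rightarrow> ereal) \<Rightarrow> 'a \<Rightarrow> ereal" where
  "moreau_env \<mu> g z = (INF w. g w + ereal (1 / (2 * \<mu>) * (norm (w - z))\<^sup>2))"

definition prox :: "('a::real_inner \<Rightarrow> ereal) \<Rightarrow> 'a \<Rightarrow> 'a" where
  "prox \<phi> z = (THE w. is_arg_min (\<lambda>w. \<phi> w + ereal (1 / 2 * (norm (w - z))\<^sup>2)) (\<lambda>_. True) w)"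

section \<open>Smoothness and cone-convexity\<close>

definition cont_differentiable :: "('a::real_normed_vector \<Rightarrow> 'b::real_normed_vector) \<Rightarrow> bool" where
  "cont_differentiable h \<longleftrightarrow>
     (\<exists>h'. (\<forall>x. (h has_derivative blinfun_apply (h' x)) (at x)) \<and> continuous_on UNIV h')"

definition gradient :: "('a::real_inner \<Rightarrow> real) \<Rightarrow> 'a \<Rightarrow> 'a" where
  "gradient f x = (THE D. GDERIV f x :> D)"

text \<open>Convexity with respect to the cone \<open>- hzn g\<close>.\<close>

definition neg_hzn_convex ::
    "('b::real_vector \<Rightarrow> ereal) \<Rightarrow> ('a::real_vector \<Rightarrow> 'b) \<Rightarrow> bool" where
  "neg_hzn_convex g c \<longleftrightarrow> (\<forall>x x'. \<forall>t\<in>{0..1}.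
     c (t *\<^sub>R x + (1 - t) *\<^sub>R x') - t *\<^sub>R c x - (1 - t) *\<^sub>R c x' \<in> hzn g)"

section \<open>The composite problem\<close>

definition objective :: "('a \<Rightarrow> real) \<Rightarrow> ('b \<Rightarrow> ereal) \<Rightarrow> ('a \<Rightarrow> 'b) \<Rightarrow> 'a \<Rightarrow> ereal" where
  "objective f g c x = ereal (f x) + g (c x)"

definition feasible :: "('b \<Rightarrow> ereal) \<Rightarrow> ('a \<Rightarrow> 'b) \<Rightarrow> 'a \<Rightarrow> bool" where
  "feasible g c x \<longleftrightarrow> c x \<in> eff_dom g"

definition minimizer :: "('a \<Rightarrow> real) \<Rightarrow> ('b \<Rightarrow> ereal) \<Rightarrow> ('a \<Rightarrow> 'b) \<Rightarrow> 'a \<Rightarrow> bool" where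
  "minimizer f g c x \<longleftrightarrow> feasible g c x \<and> (\<forall>x'. objective f g c x \<le> objective f g c x')"

definition min_value :: "('a \<Rightarrow> real) \<Rightarrow> ('b \<Rightarrow> ereal) \<Rightarrow> ('a \<Rightarrow> 'b) \<Rightarrow> ereal" where
  "min_value f g c = (INF x. objective f g c x)"

definition multipliers ::
    "(real ^ 'n \<Rightarrow> real) \<Rightarrow> (real ^ 'm \<Rightarrow> ereal) \<Rightarrow> (real ^ 'n \<Rightarrow> real ^ 'm) \<Rightarrow> real ^ 'n \<Rightarrow> (real ^ 'm) set"
  where
  "multipliers f g c x =
     {y \<in> subdiff g (c x). gradient f x + transpose (jacobian c (at x)) *v y = 0}"

definition stationary ::
    "(real ^ 'n \<Rightarrow> real) \<Rightarrow> (real ^ 'm \<Rightarrow> ereal) \<Rightarrow> (real ^ 'n \<Rightarrow> real ^ 'm) \<Rightarrow> real ^ 'n \<Rightarrow> bool" where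
  "stationary f g c x \<longleftrightarrow> feasible g c x \<and> multipliers f g c x \<noteq> {}"

text \<open>The multiplier set \<open>\<Lambda>\<close> of the problem. If some minimizer is stationary, all minimizers have the
  same multiplier set, which is then this intersection.\<close>

definition multiplier_set ::
    "(real ^ 'n \<Rightarrow> real) \<Rightarrow> (real ^ 'm \<Rightarrow> ereal) \<Rightarrow> (real ^ 'n \<Rightarrow> real ^ 'm) \<Rightarrow> (real ^ 'm) set" where
  "multiplier_set f g c = (\<Inter>x\<in>{x. minimizer f g c x}. multipliers f g c x)"

section \<open>The augmented Lagrangian method\<close>

definition aug_lagrangian ::
    "('a \<Rightarrow> real) \<Rightarrow> ('b::real_inner \<Rightarrow> ereal) \<Rightarrow> ('a \<Rightarrow> 'b) \<Rightarrow> real \<Rightarrow> 'a \<Rightarrow> 'b \<Rightarrow> ereal" where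
  "aug_lagrangian f g c \<mu> x y =
     ereal (f x) + moreau_env \<mu> g (c x + \<mu> *\<^sub>R y) - ereal (\<mu> / 2 * (norm y)\<^sup>2)"

text \<open>The sequences are a possible run of the method; the starting data are \<open>\<mu> 0\<close>, \<open>y 0\<close> and \<open>\<beta>\<close>.\<close>

definition classical_ALM ::
    "('a \<Rightarrow> real) \<Rightarrow> ('b::real_inner \<Rightarrow> ereal) \<Rightarrow> ('a \<Rightarrow> 'b) \<Rightarrow> real \<Rightarrow>
     (nat \<Rightarrow> real) \<Rightarrow> (nat \<Rightarrow> real) \<Rightarrow> (nat \<Rightarrow> 'a) \<Rightarrow> (nat \<Rightarrow> 'b) \<Rightarrow> (nat \<Rightarrow> 'b) \<Rightarrow> bool" where
  "classical_ALM f g c \<beta> \<epsilon> \<mu> x z y \<longleftrightarrow>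
     \<mu> 0 > 0 \<and> 0 < \<beta> \<and> \<beta> < 1 \<and>
     (\<forall>k. \<epsilon> k \<ge> 0 \<and>
          aug_lagrangian f g c (\<mu> k) (x k) (y k)
            \<le> (INF x'. aug_lagrangian f g c (\<mu> k) x' (y k)) + ereal (\<epsilon> k) \<and>
          z k = prox (\<lambda>w. ereal (\<mu> k) * g w) (c (x k) + \<mu> k *\<^sub>R y k) \<and>
          y (Suc k) = y k + (1 / \<mu> k) *\<^sub>R (c (x k) - z k) \<and>
          (\<exists>\<beta>k\<in>{0<..\<beta>} \<union> {1}. \<mu> (Suc k) = \<beta>k * \<mu> k))"

definition accumulation_point :: "(nat \<Rightarrow> 'a::topological_space) \<Rightarrow> 'a \<Rightarrow> bool" where
  "accumulation_point x a \<longleftrightarrow> (\<exists>r. strict_mono (r :: nat \<Rightarrow> nat) \<and> (x \<circ> r) \<longlonglongrightarrow> a)"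

end

theory Submission
  imports Defs
begin

text \<open>Let \<open>v u = inf\<^sub>x f x + g (c x + u)\<close> be the perturbed value of the problem. Cone-convexity of \<open>c\<close>
  makes \<open>v\<close> convex, and \<open>\<Lambda>\<close> is the set of subgradients of \<open>v\<close> at 0. With \<open>u\<^sup>k = z\<^sup>k - c x\<^sup>k\<close>, an
  iteration of the method chooses \<open>u\<^sup>k\<close> as an \<open>\<epsilon>\<^sub>k\<close>-minimizer of the strongly convex function
  \<open>v u - u \<bullet> y\<^sup>k + \<parallel>u\<parallel>\<^sup>2 / (2 \<mu>\<^sub>k)\<close> and sets \<open>y\<^sup>k\<^sup>+\<^sup>1 = y\<^sup>k - u\<^sup>k / \<mu>\<^sub>k\<close>. An exact minimizer would give a
  proximal point step for the dual problem, which is Fejer monotone with respect to \<open>\<Lambda>\<close>; strong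
  convexity bounds the distance from the exact step by \<open>sqrt (2 \<epsilon>\<^sub>k / \<mu>\<^sub>k)\<close>, which is summable.
  Quasi-Fejer monotonicity then gives convergence of \<open>y\<^sup>k\<close>, as well as \<open>u\<^sup>k \<rightarrow> 0\<close> and convergence of
  the values. Since \<open>v\<close> need not be lower semicontinuous, exact minimizers are replaced by limits
  of minimizing sequences.\<close>

section \<open>Minimizing sequences of strongly convex functions and proximal points\<close>

text \<open>Completing the square. It supplies the lower bound \<open>b\<close> in
  \<open>strongly_convex_limit_minimizer\<close>.\<close>

lemma linear_plus_quadratic_ge:
  fixes d w :: "'a::real_inner"
  assumes "\<mu> > 0"
  shows "- (\<mu> / 2 * (norm d)\<^sup>2) \<le> d \<bullet> w + (norm w)\<^sup>2 / (2 * \<mu>)"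
proof -
  have "0 \<le> (norm (w + \<mu> *\<^sub>R d))\<^sup>2 / (2 * \<mu>)"
    using assms by simp
  also have "\<dots> = d \<bullet> w + (norm w)\<^sup>2 / (2 * \<mu>) + \<mu> / 2 * (norm d)\<^sup>2"
    using assms
    by (simp add: power2_norm_eq_inner inner_simps inner_commute field_simps)
  finally show ?thesis by simp
qed

lemma quadratic_convex_combination:
  fixes p q :: "'a::real_inner"
  shows "(norm (t *\<^sub>R p + (1 - t) *\<^sub>R q))\<^sup>2
    = t * (norm p)\<^sup>2 + (1 - t) * (norm q)\<^sup>2 - t * (1 - t) * (norm (p - q))\<^sup>2"
  by (simp add: power2_norm_eq_inner inner_simps inner_commute algebra_simps)

text \<open>\<open>S\<close> stands for an epigraph that may fail to be closed, so the infimum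
  \<open>m\<close> may not be attained. The exact convexity defect of the squared norm makes the
  first components of a minimizing sequence Cauchy, and comparison along segments gives quadratic
  growth around their limit \<open>v\<close>.\<close>

lemma strongly_convex_limit_minimizer:
  fixes S :: "('a::{real_inner, complete_space} \<times> real) set" and y :: 'a
  defines "h \<equiv> \<lambda>\<mu> u s. s - u \<bullet> y + (norm u)\<^sup>2 / (2 * \<mu>)"
  assumes S: "convex S" "S \<noteq> {}" and \<mu>: "\<mu> > 0"
    and lower: "\<forall>(u, s)\<in>S. b \<le> h \<mu> u s"
  obtains m v us ss where
    "\<forall>n::nat. (us n, ss n) \<in> S" "us \<longlonglongrightarrow> v" "(\<lambda>n. h \<mu> (us n) (ss n)) \<longlonglongrightarrow> m"
    "\<forall>(u, s)\<in>S. m + (norm (u - v))\<^sup>2 / (2 * \<mu>) \<le> h \<mu> u s"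
proof -
  define H where "H = (\<lambda>p. h \<mu> (fst p) (snd p))"
  define m where "m = Inf (H ` S)"
  have bdd: "bdd_below (H ` S)"
    using lower by (intro bdd_belowI[of _ b]) (auto simp: H_def)
  have m_le: "m \<le> H p" if "p \<in> S" for p
    unfolding m_def using that bdd by (intro cInf_lower) auto
  have "\<exists>p\<in>S. H p < m + 1 / real (Suc n)" for n
  proof -
    have "Inf (H ` S) < m + 1 / real (Suc n)" by (simp add: m_def)
    then show ?thesis using S(2) bdd by (subst (asm) cInf_less_iff) auto
  qed
  then obtain U where U: "\<And>n. U n \<in> S" "\<And>n. H (U n) < m + 1 / real (Suc n)" by metis
  have HU: "(\<lambda>n. H (U n)) \<longlonglongrightarrow> m"
  proof (rule tendsto_sandwich[of "\<lambda>_. m" _ _ "\<lambda>n. m + 1 / real (Suc n)"])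
    show "(\<lambda>n. m + 1 / real (Suc n)) \<longlonglongrightarrow> m"
      using tendsto_add[OF tendsto_const LIMSEQ_inverse_real_of_nat, of m]
      by (simp add: inverse_eq_divide)
  qed (use m_le U in \<open>auto intro!: always_eventually less_imp_le simp del: of_nat_Suc\<close>)
  have H_comb: "H (t *\<^sub>R p + (1 - t) *\<^sub>R q)
      = t * H p + (1 - t) * H q - t * (1 - t) * ((norm (fst p - fst q))\<^sup>2 / (2 * \<mu>))" for t p q
    unfolding H_def h_def
    by (simp add: quadratic_convex_combination) (use \<mu> in \<open>simp add: inner_simps field_simps\<close>)
  have H_ge: "m \<le> t * H p + (1 - t) * H q - t * (1 - t) * ((norm (fst p - fst q))\<^sup>2 / (2 * \<mu>))"
    if "p \<in> S" "q \<in> S" "0 \<le> t" "t \<le> 1" for t p q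
    using m_le[OF convexD[OF S(1) that(1,2), of t "1 - t"]] that H_comb[of t p q] by simp
  have "Cauchy (fst \<circ> U)"
  proof (rule CauchyI)
    fix e :: real
    assume e: "e > 0"
    \<comment> \<open>At the midpoint the defect factor \<open>t * (1 - t) / (2 * \<mu>)\<close> is
      \<open>1 / (8 * \<mu>)\<close>, hence the constant 8.\<close>
    obtain N where N: "1 / real (Suc N) < e\<^sup>2 / (8 * \<mu>)"
      using e \<mu> by (metis nat_approx_posE divide_pos_pos mult_pos_pos zero_less_numeral zero_less_power)
    have "norm ((fst \<circ> U) i - (fst \<circ> U) j) < e" if ij: "N \<le> i" "N \<le> j" for i j
    proof -
      have "1 / real (Suc i) \<le> 1 / real (Suc N)" "1 / real (Suc j) \<le> 1 / real (Suc N)"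
        using ij by (auto intro!: divide_left_mono)
      then have "H (U i) < m + e\<^sup>2 / (8 * \<mu>)" "H (U j) < m + e\<^sup>2 / (8 * \<mu>)"
        using U(2)[of i] U(2)[of j] N by linarith+
      moreover have "m \<le> 1/2 * H (U i) + 1/2 * H (U j) - (norm (fst (U i) - fst (U j)))\<^sup>2 / (8 * \<mu>)"
        using H_ge[OF U(1) U(1), of "1/2" i j] by simp
      ultimately have "(norm (fst (U i) - fst (U j)))\<^sup>2 / (8 * \<mu>) < e\<^sup>2 / (8 * \<mu>)" by argo
      then have "(norm (fst (U i) - fst (U j)))\<^sup>2 < e\<^sup>2" using \<mu> by (simp add: divide_less_cancel)
      then show ?thesis using e by (simp add: power2_less_imp_less)
    qed
    then show "\<exists>N. \<forall>i\<ge>N. \<forall>j\<ge>N. norm ((fst \<circ> U) i - (fst \<circ> U) j) < e" by blast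
  qed
  then obtain v where v: "(fst \<circ> U) \<longlonglongrightarrow> v" using Cauchy_convergent convergent_def by blast
  then have v': "(\<lambda>n. fst (U n)) \<longlonglongrightarrow> v" by (simp add: o_def)
  have final: "m + (norm (u - v))\<^sup>2 / (2 * \<mu>) \<le> h \<mu> u s" if us: "(u, s) \<in> S" for u s
  proof -
    \<comment> \<open>The point \<open>(u, s)\<close> is combined with \<open>U n\<close>; after the
      limit in \<open>n\<close> and division by \<open>t\<close>, the factor \<open>1 - t\<close>
      may be taken arbitrarily close to 1.\<close>
    have *: "(1 - t) * ((norm (u - v))\<^sup>2 / (2 * \<mu>)) \<le> H (u, s) - m" if t: "0 < t" "t < 1" for t
    proof -
      have "(\<lambda>n. t * H (u, s) + (1 - t) * H (U n) - t * (1 - t) * ((norm (u - fst (U n)))\<^sup>2 / (2 * \<mu>)))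
          \<longlonglongrightarrow> t * H (u, s) + (1 - t) * m - t * (1 - t) * ((norm (u - v))\<^sup>2 / (2 * \<mu>))"
        using \<mu> by (intro tendsto_intros HU v') auto
      then have "m \<le> t * H (u, s) + (1 - t) * m - t * (1 - t) * ((norm (u - v))\<^sup>2 / (2 * \<mu>))"
        by (rule LIMSEQ_le_const) (use H_ge[OF us U(1), of t] t in auto)
      then have "t * ((1 - t) * ((norm (u - v))\<^sup>2 / (2 * \<mu>))) \<le> t * (H (u, s) - m)"
        by (simp add: algebra_simps)
      then show ?thesis by (rule mult_left_le_imp_le) (rule t)
    qed
    have "t * ((norm (u - v))\<^sup>2 / (2 * \<mu>)) \<le> H (u, s) - m" if "0 < t" "t < 1" for t
      using *[of "1 - t"] that by simp
    then have "(norm (u - v))\<^sup>2 / (2 * \<mu>) \<le> H (u, s) - m"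
      by (rule field_le_mult_one_interval)
    then show ?thesis by (simp add: H_def)
  qed
  show ?thesis
    by (rule that[of "\<lambda>n. fst (U n)" "\<lambda>n. snd (U n)" v m])
      (use U(1) v' HU final in \<open>auto simp: H_def\<close>)
qed

text \<open>Sequential closedness of the epigraph: a level strictly between \<open>\<sigma>\<close>
  and \<open>g l\<close> would eventually lie below \<open>g (w n)\<close>, hence below
  \<open>s n\<close>.\<close>

lemma lsc_fun_sequential:
  assumes lsc: "lsc_fun g" and w: "w \<longlonglongrightarrow> l" and s: "s \<longlonglongrightarrow> \<sigma>"
    and le: "\<And>n::nat. g (w n) \<le> ereal (s n)"
  shows "g l \<le> ereal \<sigma>"
proof (rule ccontr)
  assume "\<not> g l \<le> ereal \<sigma>"
  then obtain t where t: "ereal \<sigma> < ereal t" "ereal t < g l"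
    using ereal_dense2[of "ereal \<sigma>" "g l"] by (auto simp: not_le)
  have "ereal t < Liminf (at l) g" using lsc t(2) unfolding lsc_fun_def by (meson less_le_trans)
  then have "eventually (\<lambda>z. ereal t < g z) (at l)" by (rule less_LiminfD)
  \<comment> \<open>\<open>lsc_fun\<close> sees only punctured neighbourhoods, but
    \<open>w n = l\<close> is possible; the point \<open>l\<close> itself is covered by
    \<open>t(2)\<close>.\<close>
  then have "eventually (\<lambda>z. ereal t < g z) (nhds l)"
    using t(2) by (auto simp: eventually_at_filter elim!: eventually_mono)
  then have "eventually (\<lambda>n. ereal t < g (w n)) sequentially"
    using w by (rule eventually_compose_filterlim)
  then have "eventually (\<lambda>n. t \<le> s n) sequentially"
    by (rule eventually_mono) (use le in \<open>metis ereal_less_eq(3) less_imp_le order_trans\<close>)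
  then have "t \<le> \<sigma>" using s by (intro tendsto_lowerbound) auto
  then show False using t(1) by simp
qed

lemma convex_funD_real:
  assumes g: "convex_fun g" and le: "g w \<le> ereal s" "g w' \<le> ereal s'" and t: "0 \<le> t" "t \<le> 1"
  shows "g (t *\<^sub>R w + (1 - t) *\<^sub>R w') \<le> ereal (t * s + (1 - t) * s')"
proof -
  have "g (t *\<^sub>R w + (1 - t) *\<^sub>R w') \<le> ereal t * g w + ereal (1 - t) * g w'"
    using g t unfolding convex_fun_def by simp
  also have "\<dots> \<le> ereal t * ereal s + ereal (1 - t) * ereal s'"
    using le t by (intro add_mono ereal_mult_left_mono) auto
  finally show ?thesis by simp
qed

text \<open>Strong convexity gives a limit of minimizers over the epigraph of \<open>g\<close>,
  lower semicontinuity makes it attain the infimum, and quadratic growth makes it unique, so the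
  description in \<open>prox\<close> denotes it. Scaling by \<open>\<mu>\<close> passes between
  \<open>prox\<close> and the form used in \<open>moreau_env\<close>.\<close>

lemma prox_minimizes:
  fixes g :: "'a::{real_inner, complete_space} \<Rightarrow> ereal" and a :: 'a
  defines "P \<equiv> \<lambda>\<mu>. prox (\<lambda>w. ereal \<mu> * g w) a"
  assumes g: "proper_fun g" "lsc_fun g" "convex_fun g"
    and minor: "\<And>w. ereal (p \<bullet> w + q) \<le> g w" and \<mu>: "\<mu> > 0"
  shows "\<bar>g (P \<mu>)\<bar> \<noteq> \<infinity>"
    and "g (P \<mu>) + ereal (1 / (2 * \<mu>) * (norm (P \<mu> - a))\<^sup>2)
      \<le> g w + ereal (1 / (2 * \<mu>) * (norm (w - a))\<^sup>2)"
proof -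
  define S where "S = {(w, s). g w \<le> ereal s}"
  \<comment> \<open>With this slope, the squared distance to \<open>a\<close> divided by
    \<open>2 * \<mu>\<close> becomes the linear plus quadratic term of
    \<open>strongly_convex_limit_minimizer\<close>, up to a constant.\<close>
  define b where "b = a /\<^sub>R \<mu>"
  have S: "convex S"
  proof (rule convexI)
    fix x y :: "'a \<times> real" and u v :: real
    assume "x \<in> S" "y \<in> S" "0 \<le> u" "0 \<le> v" "u + v = 1"
    moreover from this have "v = 1 - u" by simp
    ultimately show "u *\<^sub>R x + v *\<^sub>R y \<in> S"
      using convex_funD_real[OF g(3), of "fst x" "snd x" "fst y" "snd y" u]
      by (auto simp: S_def case_prod_unfold)
  qed
  have fin: "g w \<noteq> -\<infinity>" for w using g(1) by (simp add: proper_fun_def)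
  obtain w0 where "g w0 < \<infinity>" using g(1) by (auto simp: proper_fun_def eff_dom_def)
  then obtain s0 where "g w0 = ereal s0" using fin[of w0] by (cases "g w0") auto
  then have "(w0, s0) \<in> S" by (simp add: S_def)
  then have ne: "S \<noteq> {}" by blast
  have low: "\<forall>(w, s)\<in>S. q - \<mu> / 2 * (norm (p - b))\<^sup>2 \<le> s - w \<bullet> b + (norm w)\<^sup>2 / (2 * \<mu>)"
  proof safe
    fix w s assume that: "(w, s) \<in> S"
    have "g w \<le> ereal s" using that by (simp add: S_def)
    then have "ereal (p \<bullet> w + q) \<le> ereal s" by (rule order_trans[OF minor])
    then show "q - \<mu> / 2 * (norm (p - b))\<^sup>2 \<le> s - w \<bullet> b + (norm w)\<^sup>2 / (2 * \<mu>)" using linear_plus_quadratic_ge[OF \<mu>, of "p - b" w]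
      by (simp add: inner_diff_left inner_diff_right inner_commute)
  qed
  obtain m v us ss where
    lim: "\<forall>n::nat. (us n, ss n) \<in> S" "us \<longlonglongrightarrow> v"
      "(\<lambda>n. ss n - us n \<bullet> b + (norm (us n))\<^sup>2 / (2 * \<mu>)) \<longlonglongrightarrow> m"
    and min_ball: "\<forall>(u, s)\<in>S.
      m + (norm (u - v))\<^sup>2 / (2 * \<mu>) \<le> s - u \<bullet> b + (norm u)\<^sup>2 / (2 * \<mu>)"
    by (rule strongly_convex_limit_minimizer[OF S ne \<mu> low])
  have min: "m + (norm (u - v))\<^sup>2 / (2 * \<mu>) \<le> s - u \<bullet> b + (norm u)\<^sup>2 / (2 * \<mu>)"
    if "(u, s) \<in> S" for u s
    using min_ball that by blast
  \<comment> \<open>The only possible limit of \<open>ss\<close>, obtained by solving the limit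
    relation for \<open>m\<close>. Lower semicontinuity gives \<open>g v \<le> \<sigma>\<close>, and
    the minimality of \<open>m\<close> at \<open>v\<close> gives the reverse inequality.\<close>
  define \<sigma> where "\<sigma> = m + v \<bullet> b - (norm v)\<^sup>2 / (2 * \<mu>)"
  have "(\<lambda>n. (ss n - us n \<bullet> b + (norm (us n))\<^sup>2 / (2 * \<mu>)) + us n \<bullet> b - (norm (us n))\<^sup>2 / (2 * \<mu>)) \<longlonglongrightarrow> \<sigma>"
    unfolding \<sigma>_def using \<mu> by (intro tendsto_intros lim) auto
  then have "ss \<longlonglongrightarrow> \<sigma>" by simp
  then have "g v \<le> ereal \<sigma>"
    by (rule lsc_fun_sequential[OF g(2) lim(2)]) (use lim(1) in \<open>simp add: S_def\<close>)
  then obtain r where r: "g v = ereal r" "r \<le> \<sigma>" using fin[of v] by (cases "g v") auto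
  have "m \<le> r - v \<bullet> b + (norm v)\<^sup>2 / (2 * \<mu>)" using min[of v r] r by (simp add: S_def)
  then have r_eq: "r = \<sigma>" using r(2) by (simp add: \<sigma>_def)
  have sq: "1 / (2 * \<mu>) * (norm (w - a))\<^sup>2 = (norm w)\<^sup>2 / (2 * \<mu>) - w \<bullet> b + (norm a)\<^sup>2 / (2 * \<mu>)" for w
    using \<mu> by (simp add: b_def power2_norm_eq_inner inner_simps inner_commute field_simps)
  define M where "M = m + (norm a)\<^sup>2 / (2 * \<mu>)"
  have gv: "g v + ereal (1 / (2 * \<mu>) * (norm (v - a))\<^sup>2) = ereal M"
    unfolding sq by (simp add: r r_eq M_def \<sigma>_def)
  have gw: "ereal (M + (norm (w - v))\<^sup>2 / (2 * \<mu>)) \<le> g w + ereal (1 / (2 * \<mu>) * (norm (w - a))\<^sup>2)" for w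
  proof (cases "g w")
    case (real s)
    then show ?thesis using min[of w s] unfolding sq by (simp add: S_def M_def)
  qed (use fin in auto)
  define E where "E = (\<lambda>w. ereal \<mu> * g w + ereal (1 / 2 * (norm (w - a))\<^sup>2))"
  have E: "E w = ereal \<mu> * (g w + ereal (1 / (2 * \<mu>) * (norm (w - a))\<^sup>2))" for w
    using \<mu> fin[of w] by (cases "g w") (auto simp: E_def field_simps)
  have Ev: "E v = ereal (\<mu> * M)" by (simp only: E gv) simp
  have Ew: "ereal (\<mu> * M + (norm (w - v))\<^sup>2 / 2) \<le> E w" for w
    using ereal_mult_left_mono[OF gw[of w], of "ereal \<mu>"] \<mu> by (simp add: E distrib_left)
  have "P \<mu> = v"
    unfolding P_def prox_def E_def[symmetric]
  proof (rule the_equality)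
    have "E v \<le> E w" for w
      unfolding Ev by (rule order_trans[OF _ Ew[of w]]) simp
    then show "is_arg_min E (\<lambda>_. True) v" by (simp add: is_arg_min_def not_less)
  next
    fix w assume "is_arg_min E (\<lambda>_. True) w"
    then have "E w \<le> E v" by (simp add: is_arg_min_def not_less)
    with Ew[of w] have "ereal (\<mu> * M + (norm (w - v))\<^sup>2 / 2) \<le> ereal (\<mu> * M)"
      unfolding Ev by (rule order_trans)
    then show "w = v" by simp
  qed
  then show "\<bar>g (P \<mu>)\<bar> \<noteq> \<infinity>" using r by simp
  show "g (P \<mu>) + ereal (1 / (2 * \<mu>) * (norm (P \<mu> - a))\<^sup>2)
      \<le> g w + ereal (1 / (2 * \<mu>) * (norm (w - a))\<^sup>2)"
    unfolding \<open>P \<mu> = v\<close> gv using \<mu> by (intro order_trans[OF _ gw[of w]]) simp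
qed

section \<open>Proximal point steps for the dual problem\<close>

text \<open>If \<open>S\<close> is the epigraph of \<open>v\<close> and \<open>v0 = v 0\<close>, these are the subgradients of \<open>v\<close> at 0.\<close>

definition support_slopes :: "('a::real_inner \<times> real) set \<Rightarrow> real \<Rightarrow> 'a set" where
  "support_slopes S v0 = {p. \<forall>(u, s)\<in>S. v0 + p \<bullet> u \<le> s}"

text \<open>The support slopes are the maximizers of the concave dual function
  \<open>p \<mapsto> inf (s - p \<bullet> u)\<close> over \<open>S\<close>, and \<open>yh\<close> is
  its proximal step from \<open>y\<close>. The conclusions are the Fejer inequality, a support
  inequality for \<open>yh\<close> with an error that is small when \<open>y - yh\<close> is, and
  the effect of minimizing only up to \<open>e\<close>.\<close>

lemma exact_dual_step:
  fixes S :: "('a::{real_inner, complete_space} \<times> real) set" and y :: 'a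
  assumes S: "convex S" "(0, v0) \<in> S" and \<mu>: "\<mu> > 0" and D: "support_slopes S v0 \<noteq> {}"
  obtains yh where
    "\<forall>p\<in>support_slopes S v0. (norm (yh - p))\<^sup>2 + (norm (y - yh))\<^sup>2 \<le> (norm (y - p))\<^sup>2"
    "\<forall>p\<in>support_slopes S v0. \<forall>(u, s)\<in>S. v0 + yh \<bullet> u + \<mu> * ((p - y) \<bullet> (y - yh)) \<le> s"
    "\<forall>(u, s)\<in>S. \<forall>e.
      (\<forall>(u', s')\<in>S. s - u \<bullet> y + (norm u)\<^sup>2 / (2 * \<mu>) \<le> s' - u' \<bullet> y + (norm u')\<^sup>2 / (2 * \<mu>) + e)
      \<longrightarrow> (norm (y - (1 / \<mu>) *\<^sub>R u - yh))\<^sup>2 \<le> 2 * (e / \<mu>)"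
proof -
  obtain p0 where p0: "p0 \<in> support_slopes S v0" using D by blast
  have low: "v0 - \<mu> / 2 * (norm (p - y))\<^sup>2 \<le> s - u \<bullet> y + (norm u)\<^sup>2 / (2 * \<mu>)"
    if "(u, s) \<in> S" "p \<in> support_slopes S v0" for p u s
    using linear_plus_quadratic_ge[OF \<mu>, of "p - y" u] that
    by (fastforce simp: support_slopes_def inner_diff_left inner_diff_right inner_commute)
  have ne: "S \<noteq> {}" using S by blast
  obtain m v us ss where
    lim: "\<forall>n::nat. (us n, ss n) \<in> S" "us \<longlonglongrightarrow> v"
      "(\<lambda>n. ss n - us n \<bullet> y + (norm (us n))\<^sup>2 / (2 * \<mu>)) \<longlonglongrightarrow> m"
    and min_ball: "\<forall>(u, s)\<in>S.
      m + (norm (u - v))\<^sup>2 / (2 * \<mu>) \<le> s - u \<bullet> y + (norm u)\<^sup>2 / (2 * \<mu>)"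
    by (rule strongly_convex_limit_minimizer[OF S(1) ne \<mu>, of "v0 - \<mu> / 2 * (norm (p0 - y))\<^sup>2"])
      (use low[OF _ p0] in auto)
  have min: "m + (norm (u - v))\<^sup>2 / (2 * \<mu>) \<le> s - u \<bullet> y + (norm u)\<^sup>2 / (2 * \<mu>)"
    if "(u, s) \<in> S" for u s
    using min_ball that by blast
  define yh where "yh = y - (1 / \<mu>) *\<^sub>R v"
  have v: "v = \<mu> *\<^sub>R (y - yh)" using \<mu> by (simp add: yh_def)
  \<comment> \<open>The support inequality is carried along \<open>us\<close>, since
    \<open>v\<close> itself may not belong to a point of \<open>S\<close>.\<close>
  have m_ge: "v0 + (p - y) \<bullet> v + (norm v)\<^sup>2 / (2 * \<mu>) \<le> m" if p: "p \<in> support_slopes S v0" for p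
  proof (rule LIMSEQ_le[OF _ lim(3)])
    show "(\<lambda>n. v0 + (p - y) \<bullet> us n + (norm (us n))\<^sup>2 / (2 * \<mu>))
        \<longlonglongrightarrow> v0 + (p - y) \<bullet> v + (norm v)\<^sup>2 / (2 * \<mu>)"
      using \<mu> by (intro tendsto_intros lim(2)) auto
    have "v0 + p \<bullet> us n \<le> ss n" for n
      using lim(1) p by (auto simp: support_slopes_def)
    then show "\<exists>N. \<forall>n\<ge>N. v0 + (p - y) \<bullet> us n + (norm (us n))\<^sup>2 / (2 * \<mu>)
        \<le> ss n - us n \<bullet> y + (norm (us n))\<^sup>2 / (2 * \<mu>)"
      by (simp add: inner_diff_left inner_diff_right inner_commute)
  qed
  \<comment> \<open>Expanding the square in the quadratic growth cancels the terms in
    \<open>(norm u)\<^sup>2\<close> and leaves an affine minorant with slope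
    \<open>yh\<close>.\<close>
  have affine: "m + (norm v)\<^sup>2 / (2 * \<mu>) + yh \<bullet> u \<le> s" if "(u, s) \<in> S" for u s
    using min[OF that] \<mu>
    by (simp add: yh_def power2_norm_eq_inner inner_simps inner_commute field_simps)
  show ?thesis
  proof (rule that[of yh]; safe)
    fix p assume p: "p \<in> support_slopes S v0"
    \<comment> \<open>Evaluating the minorant at \<open>(0, v0)\<close> bounds \<open>m\<close> from
      above; together with \<open>m_ge\<close> this is the angle condition
      \<open>(p - yh) \<bullet> (y - yh) \<le> 0\<close>, which is equivalent to the Fejer
      inequality with the extra factor 2 on the inner product dropped.\<close>
    have "(norm v)\<^sup>2 / \<mu> + (p - y) \<bullet> v \<le> 0"
      using m_ge[OF p] affine[OF S(2)] by simp
    moreover have "(norm v)\<^sup>2 / \<mu> + (p - y) \<bullet> v = \<mu> * ((p - yh) \<bullet> (y - yh))"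
      unfolding v using \<mu>
      by (simp add: power2_norm_eq_inner inner_simps inner_commute field_simps)
    ultimately have "(p - yh) \<bullet> (y - yh) \<le> 0" using \<mu> by (simp add: mult_le_0_iff)
    then show "(norm (yh - p))\<^sup>2 + (norm (y - yh))\<^sup>2 \<le> (norm (y - p))\<^sup>2"
      by (simp add: power2_norm_eq_inner inner_simps inner_commute)
  next
    fix p u s assume p: "p \<in> support_slopes S v0" and us: "(u, s) \<in> S"
    have "(p - y) \<bullet> v = \<mu> * ((p - y) \<bullet> (y - yh))" by (simp add: v)
    moreover have "0 \<le> (norm v)\<^sup>2 / (2 * \<mu>)" using \<mu> by simp
    ultimately show "v0 + yh \<bullet> u + \<mu> * ((p - y) \<bullet> (y - yh)) \<le> s"
      using m_ge[OF p] affine[OF us] by linarith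
  next
    fix u s e assume us: "(u, s) \<in> S"
      and near: "\<forall>(u', s')\<in>S.
        s - u \<bullet> y + (norm u)\<^sup>2 / (2 * \<mu>) \<le> s' - u' \<bullet> y + (norm u')\<^sup>2 / (2 * \<mu>) + e"
    have "s - u \<bullet> y + (norm u)\<^sup>2 / (2 * \<mu>) \<le> ss n - us n \<bullet> y + (norm (us n))\<^sup>2 / (2 * \<mu>) + e" for n
      using near lim(1) by blast
    then have "s - u \<bullet> y + (norm u)\<^sup>2 / (2 * \<mu>) - e \<le> m"
      by (intro LIMSEQ_le_const[OF lim(3)]) (simp add: diff_le_eq)
    with min[OF us] have "(norm (u - v))\<^sup>2 / (2 * \<mu>) \<le> e" by simp
    moreover have "y - (1 / \<mu>) *\<^sub>R u - yh = (- 1 / \<mu>) *\<^sub>R (u - v)"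
      by (simp add: yh_def algebra_simps)
    then have "(norm (y - (1 / \<mu>) *\<^sub>R u - yh))\<^sup>2 = 2 / \<mu> * ((norm (u - v))\<^sup>2 / (2 * \<mu>))"
      by (simp add: power_divide power2_eq_square)
    ultimately show "(norm (y - (1 / \<mu>) *\<^sub>R u - yh))\<^sup>2 \<le> 2 * (e / \<mu>)"
      using \<mu> mult_left_mono[of "(norm (u - v))\<^sup>2 / (2 * \<mu>)" e "2 / \<mu>"] by simp
  qed
qed

text \<open>Subtracting the partial sums of \<open>e\<close> makes \<open>a\<close> decreasing, and
  summability keeps the difference bounded below.\<close>

lemma quasi_fejer_convergent:
  fixes a e :: "nat \<Rightarrow> real"
  assumes a: "\<And>k. 0 \<le> a k" and step: "\<And>k. a (Suc k) \<le> a k + e k"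
    and e: "summable e" "\<And>k. 0 \<le> e k"
  shows "convergent a"
proof -
  define d where "d = (\<lambda>k. a k - sum e {..<k})"
  have "decseq d" unfolding d_def decseq_Suc_iff using step by (simp add: algebra_simps)
  moreover have "- suminf e \<le> d k" for k
    using a[of k] sum_le_suminf[OF e(1), of "{..<k}"] e(2) by (simp add: d_def)
  ultimately have "convergent d" using decseq_convergent[of d "- suminf e"] convergent_def by metis
  moreover have "convergent (\<lambda>k. sum e {..<k})" using e(1) summable_iff_convergent by blast
  ultimately have "convergent (\<lambda>k. d k + sum e {..<k})" by (rule convergent_add)
  then show ?thesis by (simp add: d_def)
qed

text \<open>Each step is an exact proximal step up to a summable error, so the distance to every
  support slope converges; a cluster point that is itself a support slope must then be the limit.
  The parameters may tend to 0; the bound \<open>B\<close> keeps null sequences null after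
  multiplication by \<open>\<mu> k\<close>.\<close>

theorem inexact_dual_proximal_point:
  fixes S :: "('a::euclidean_space \<times> real) set" and y u :: "nat \<Rightarrow> 'a"
  assumes S: "convex S" "(0, v0) \<in> S" and D: "support_slopes S v0 \<noteq> {}"
    and \<mu>: "\<And>k. 0 < \<mu> k" "\<And>k. \<mu> k \<le> B"
    and e: "\<And>k. 0 \<le> e k" and summ: "summable (\<lambda>k. sqrt (e k / \<mu> k))"
    and us: "\<And>k. (u k, s k) \<in> S"
    and near: "\<And>k u' s'. (u', s') \<in> S \<Longrightarrow>
        s k - u k \<bullet> y k + (norm (u k))\<^sup>2 / (2 * \<mu> k)
          \<le> s' - u' \<bullet> y k + (norm u')\<^sup>2 / (2 * \<mu> k) + e k"
    and y: "\<And>k. y (Suc k) = y k - (1 / \<mu> k) *\<^sub>R u k"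
  shows "\<exists>p\<in>support_slopes S v0. y \<longlonglongrightarrow> p" and "u \<longlonglongrightarrow> 0" and "s \<longlonglongrightarrow> v0"
proof -
  \<comment> \<open>The square root of the error bound in the last conclusion of
    \<open>exact_dual_step\<close>.\<close>
  define \<delta> where "\<delta> = (\<lambda>k. sqrt 2 * sqrt (e k / \<mu> k))"
  have \<delta>0: "0 \<le> \<delta> k" for k using \<mu>(1)[of k] e[of k] by (simp add: \<delta>_def)
  have \<delta>sum: "summable \<delta>" unfolding \<delta>_def using summ by (rule summable_mult)
  then have \<delta>lim: "\<delta> \<longlonglongrightarrow> 0" by (rule summable_LIMSEQ_zero)
  have "\<forall>k. \<exists>yh. (\<forall>p\<in>support_slopes S v0. (norm (yh - p))\<^sup>2 + (norm (y k - yh))\<^sup>2 \<le> (norm (y k - p))\<^sup>2) \<and>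
     (\<forall>p\<in>support_slopes S v0. \<forall>(u, s)\<in>S. v0 + yh \<bullet> u + \<mu> k * ((p - y k) \<bullet> (y k - yh)) \<le> s) \<and>
     norm (y (Suc k) - yh) \<le> \<delta> k" (is "\<forall>k. ?yh_exists k")
  proof
    fix k
    obtain yh where
      1: "\<forall>p\<in>support_slopes S v0. (norm (yh - p))\<^sup>2 + (norm (y k - yh))\<^sup>2 \<le> (norm (y k - p))\<^sup>2" and
      2: "\<forall>p\<in>support_slopes S v0. \<forall>(u, s)\<in>S. v0 + yh \<bullet> u + \<mu> k * ((p - y k) \<bullet> (y k - yh)) \<le> s" and
      3: "\<forall>(u, s)\<in>S. \<forall>e.
        (\<forall>(u', s')\<in>S. s - u \<bullet> y k + (norm u)\<^sup>2 / (2 * \<mu> k) \<le> s' - u' \<bullet> y k + (norm u')\<^sup>2 / (2 * \<mu> k) + e)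
        \<longrightarrow> (norm (y k - (1 / \<mu> k) *\<^sub>R u - yh))\<^sup>2 \<le> 2 * (e / \<mu> k)"
      by (rule exact_dual_step[OF S \<mu>(1)[of k] D, of "y k"])
    have "(norm (y (Suc k) - yh))\<^sup>2 \<le> 2 * (e k / \<mu> k)"
      unfolding y using 3 us[of k] near[of _ _ k] by blast
    also have "\<dots> = (\<delta> k)\<^sup>2" using \<mu>(1)[of k] e[of k] by (simp add: \<delta>_def power_mult_distrib)
    finally have "norm (y (Suc k) - yh) \<le> \<delta> k" using \<delta>0 by (rule power2_le_imp_le)
    then show "?yh_exists k" using 1 2 by blast
  qed
  from choice[OF this] obtain yh where
    fejer: "\<And>p k. p \<in> support_slopes S v0 \<Longrightarrow> (norm (yh k - p))\<^sup>2 + (norm (y k - yh k))\<^sup>2 \<le> (norm (y k - p))\<^sup>2" and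
    affine: "\<And>p k u s. p \<in> support_slopes S v0 \<Longrightarrow> (u, s) \<in> S \<Longrightarrow>
      v0 + yh k \<bullet> u + \<mu> k * ((p - y k) \<bullet> (y k - yh k)) \<le> s" and
    err: "\<And>k. norm (y (Suc k) - yh k) \<le> \<delta> k"
    by blast
  have err0: "(\<lambda>k. y (Suc k) - yh k) \<longlonglongrightarrow> 0"
    by (rule Lim_null_comparison[OF _ \<delta>lim]) (use err in auto)
  have conv: "convergent (\<lambda>k. norm (y k - p))" if p: "p \<in> support_slopes S v0" for p
  proof (rule quasi_fejer_convergent[OF _ _ \<delta>sum \<delta>0])
    fix k
    have "(norm (yh k - p))\<^sup>2 \<le> (norm (y k - p))\<^sup>2"
      using fejer[OF p, of k] zero_le_power2[of "norm (y k - yh k)"] by linarith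
    then have "norm (yh k - p) \<le> norm (y k - p)" by (rule power2_le_imp_le) simp
    then show "norm (y (Suc k) - p) \<le> norm (y k - p) + \<delta> k"
      using err[of k] norm_triangle_ineq[of "y (Suc k) - yh k" "yh k - p"] by simp
  qed simp
  obtain q where q: "q \<in> support_slopes S v0" using D by blast
  then obtain L where L: "(\<lambda>k. norm (y k - q)) \<longlonglongrightarrow> L" using conv convergent_def by blast
  \<comment> \<open>Both \<open>y k\<close> and \<open>yh k\<close> have distance to
    \<open>q\<close> tending to \<open>L\<close>, so the Fejer inequality squeezes the step length
    \<open>norm (y k - yh k)\<close> to 0.\<close>
  have "(\<lambda>k. norm (y (Suc k) - q) - norm (yh k - q)) \<longlonglongrightarrow> 0"
    by (rule Lim_null_comparison[OF _ tendsto_norm_zero[OF err0]])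
      (use norm_triangle_ineq3[of "y (Suc k) - q" "yh k - q" for k] in simp)
  then have "(\<lambda>k. norm (y (Suc k) - q) - (norm (y (Suc k) - q) - norm (yh k - q))) \<longlonglongrightarrow> L - 0"
    using LIMSEQ_Suc[OF L] by (intro tendsto_diff)
  then have Lh: "(\<lambda>k. norm (yh k - q)) \<longlonglongrightarrow> L" by simp
  have sq0: "(\<lambda>k. (norm (y k - yh k))\<^sup>2) \<longlonglongrightarrow> 0"
  proof (rule Lim_null_comparison)
    show "(\<lambda>k. (norm (y k - q))\<^sup>2 - (norm (yh k - q))\<^sup>2) \<longlonglongrightarrow> 0"
      using tendsto_diff[OF tendsto_power[OF L, of 2] tendsto_power[OF Lh, of 2]] by simp
  qed (use fejer[OF q] in \<open>simp add: algebra_simps\<close>)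
  then have yyh: "(\<lambda>k. y k - yh k) \<longlonglongrightarrow> 0"
    using tendsto_real_sqrt[OF sq0] by (simp add: tendsto_norm_zero_iff)
  then have "(\<lambda>k. (y k - yh k) - (y (Suc k) - yh k)) \<longlonglongrightarrow> 0 - 0"
    using err0 by (intro tendsto_diff)
  then have dy: "(\<lambda>k. y k - y (Suc k)) \<longlonglongrightarrow> 0" by simp
  have scale: "(\<lambda>k. \<mu> k *\<^sub>R w k) \<longlonglongrightarrow> 0" if "w \<longlonglongrightarrow> 0" for w :: "nat \<Rightarrow> 'b::real_normed_vector"
  proof (rule Lim_null_comparison[of _ "\<lambda>k. B * norm (w k)"])
    show "(\<lambda>k. B * norm (w k)) \<longlonglongrightarrow> 0"
      using tendsto_mult[OF tendsto_const tendsto_norm_zero[OF that], of B] by simp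
    show "eventually (\<lambda>k. norm (\<mu> k *\<^sub>R w k) \<le> B * norm (w k)) sequentially"
      using \<mu> by (auto intro!: always_eventually mult_right_mono simp: abs_of_pos)
  qed
  have "u k = \<mu> k *\<^sub>R (y k - y (Suc k))" for k using \<mu>(1)[of k] by (simp add: y)
  then show u0: "u \<longlonglongrightarrow> 0" using scale[OF dy] by presburger
  have bnd: "bounded (range y)"
  proof -
    have "bounded (range (\<lambda>k. norm (y k - q)))" using L by (metis convergent_imp_bounded)
    then obtain C where "\<And>k. norm (y k - q) \<le> C" by (auto simp: bounded_iff)
    then have "norm (y k) \<le> C + norm q" for k using norm_triangle_sub[of "y k" q] by (smt (verit))
    then show ?thesis by (auto simp: bounded_iff)
  qed
  then obtain p r where r: "strict_mono (r::nat \<Rightarrow> nat)" and p: "(y \<circ> r) \<longlonglongrightarrow> p"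
    using bounded_imp_convergent_subsequence by blast
  have yr: "(\<lambda>k. y (r k)) \<longlonglongrightarrow> p" using p by (simp add: o_def)
  have sub: "(\<lambda>k. w (r k)) \<longlonglongrightarrow> l" if "w \<longlonglongrightarrow> l" for w l
    using LIMSEQ_subseq_LIMSEQ[OF that r] by (simp add: o_def)
  have yhr: "(\<lambda>k. yh (r k)) \<longlonglongrightarrow> p"
    using tendsto_diff[OF yr sub[OF yyh]] by simp
  have "p \<in> support_slopes S v0"
    unfolding support_slopes_def
  proof safe
    fix u' s' assume S': "(u', s') \<in> S"
    \<comment> \<open>Grouping \<open>\<mu>\<close> with \<open>y - yh\<close> makes the error of
      the support inequality vanish along the subsequence.\<close>
    have "(\<lambda>k. v0 + yh (r k) \<bullet> u' + (q - y (r k)) \<bullet> (\<mu> (r k) *\<^sub>R (y (r k) - yh (r k))))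
        \<longlonglongrightarrow> v0 + p \<bullet> u' + (q - p) \<bullet> 0"
      by (intro tendsto_intros yhr yr sub[OF scale[OF yyh]])
    then show "v0 + p \<bullet> u' \<le> s'"
      by (intro LIMSEQ_le_const2[of _ "v0 + p \<bullet> u'" s']) (use affine[OF q S'] in auto)
  qed
  moreover have "y \<longlonglongrightarrow> p"
  proof -
    obtain l where l: "(\<lambda>k. norm (y k - p)) \<longlonglongrightarrow> l" using conv[OF \<open>p \<in> support_slopes S v0\<close>] convergent_def by blast
    moreover have "(\<lambda>k. norm (y (r k) - p)) \<longlonglongrightarrow> 0"
      using tendsto_norm[OF tendsto_diff[OF yr tendsto_const[of p]]] by simp
    ultimately have "l = 0" using sub LIMSEQ_unique by blast
    then show ?thesis using l by (simp add: tendsto_norm_zero_iff LIM_zero_iff)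
  qed
  ultimately show "\<exists>p\<in>support_slopes S v0. y \<longlonglongrightarrow> p" by blast
  \<comment> \<open>Summability controls only \<open>e k / \<mu> k\<close>; multiplying by the
    bounded \<open>\<mu> k\<close> recovers \<open>e\<close>.\<close>
  have "(\<lambda>k. (sqrt (e k / \<mu> k))\<^sup>2) \<longlonglongrightarrow> 0"
    using tendsto_power[OF summable_LIMSEQ_zero[OF summ], of 2] by simp
  then have "(\<lambda>k. e k / \<mu> k) \<longlonglongrightarrow> 0" using e \<mu>(1) by (simp add: less_imp_le)
  from scale[OF this] have e0: "e \<longlonglongrightarrow> 0" using \<mu>(1) by (simp add: less_imp_neq[symmetric])
  \<comment> \<open>The lower bound is the support inequality for \<open>q\<close>; the upper bound
    compares the iterate with \<open>(0, v0)\<close> in \<open>near\<close>.\<close>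
  show "s \<longlonglongrightarrow> v0"
  proof (rule tendsto_sandwich)
    show "(\<lambda>k. v0 + q \<bullet> u k) \<longlonglongrightarrow> v0"
      using tendsto_add[OF tendsto_const tendsto_inner[OF tendsto_const u0], of v0 q] by simp
    show "(\<lambda>k. v0 + u k \<bullet> y k + e k) \<longlonglongrightarrow> v0"
      using tendsto_add[OF tendsto_add[OF tendsto_const tendsto_inner[OF u0 \<open>y \<longlonglongrightarrow> p\<close>]] e0, of v0] by simp
    show "eventually (\<lambda>k. v0 + q \<bullet> u k \<le> s k) sequentially"
      using us q unfolding support_slopes_def by (intro always_eventually) blast
    have "s k \<le> v0 + u k \<bullet> y k + e k" for k
    proof -
      have "0 \<le> (norm (u k))\<^sup>2 / (2 * \<mu> k)" using \<mu>(1)[of k] by simp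
      then show ?thesis using near[OF S(2), of k] by simp
    qed
    then show "eventually (\<lambda>k. s k \<le> v0 + u k \<bullet> y k + e k) sequentially" by simp
  qed
qed


section \<open>The perturbed value function and its subgradients\<close>

text \<open>Between the strict epigraph and the epigraph of the perturbed value function \<open>v\<close>.\<close>

definition perturbation_epigraph ::
    "('a \<Rightarrow> real) \<Rightarrow> ('b::plus \<Rightarrow> ereal) \<Rightarrow> ('a \<Rightarrow> 'b) \<Rightarrow> ('b \<times> real) set" where
  "perturbation_epigraph f g c = {(u, s). \<exists>x. g (c x + u) \<le> ereal (s - f x)}"

text \<open>The convex combination of the two arguments of \<open>g\<close> differs from the
  argument required at \<open>xt\<close> by a horizon vector, and adding that vector does not
  increase \<open>g\<close>.\<close>

lemma convex_perturbation_epigraph: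
  fixes f :: "'a::real_vector \<Rightarrow> real" and g :: "'b::real_vector \<Rightarrow> ereal"
  assumes f: "convex_on UNIV f" and g: "convex_fun g" and c: "neg_hzn_convex g c"
  shows "convex (perturbation_epigraph f g c)"
proof (rule convexI)
  fix p q :: "'b \<times> real" and t t' :: real
  assume p: "p \<in> perturbation_epigraph f g c" and q: "q \<in> perturbation_epigraph f g c"
    and t: "0 \<le> t" "0 \<le> t'" "t + t' = 1"
  obtain u s u' s' where pq: "p = (u, s)" "q = (u', s')" by (cases p, cases q)
  obtain x x' where x: "g (c x + u) \<le> ereal (s - f x)" and x': "g (c x' + u') \<le> ereal (s' - f x')"
    using p q by (auto simp: pq perturbation_epigraph_def)
  have t': "t' = 1 - t" "t \<le> 1" using t by auto
  define w where "w = t *\<^sub>R (c x + u) + (1 - t) *\<^sub>R (c x' + u')"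
  define xt where "xt = t *\<^sub>R x + (1 - t) *\<^sub>R x'"
  have gw: "g w \<le> ereal (t * (s - f x) + (1 - t) * (s' - f x'))"
    unfolding w_def using convex_funD_real[OF g x x'] t(1) t'(2) by simp
  \<comment> \<open>Horizon vectors control \<open>g\<close> only from points of its domain.\<close>
  then have "w \<in> eff_dom g" by (auto simp: eff_dom_def intro: le_less_trans)
  moreover have "c xt - t *\<^sub>R c x - (1 - t) *\<^sub>R c x' \<in> hzn g"
    unfolding xt_def using c t(1) t'(2) by (simp add: neg_hzn_convex_def)
  ultimately have "g (w + (c xt - t *\<^sub>R c x - (1 - t) *\<^sub>R c x')) \<le> g w" by (simp add: hzn_def)
  moreover have "w + (c xt - t *\<^sub>R c x - (1 - t) *\<^sub>R c x') = c xt + (t *\<^sub>R u + (1 - t) *\<^sub>R u')"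
    by (simp add: w_def algebra_simps)
  ultimately have "g (c xt + (t *\<^sub>R u + (1 - t) *\<^sub>R u')) \<le> ereal (t * (s - f x) + (1 - t) * (s' - f x'))"
    using gw by simp
  moreover have "f xt \<le> t * f x + (1 - t) * f x'"
    unfolding xt_def using convex_onD[OF f, of "1 - t" x x'] t(1) t'(2) by simp
  then have "t * (s - f x) + (1 - t) * (s' - f x') \<le> t * s + (1 - t) * s' - f xt"
    by (simp add: algebra_simps)
  ultimately have "g (c xt + (t *\<^sub>R u + (1 - t) *\<^sub>R u')) \<le> ereal (t * s + (1 - t) * s' - f xt)"
    using order_trans ereal_less_eq(3) by blast
  then show "t *\<^sub>R p + t' *\<^sub>R q \<in> perturbation_epigraph f g c"
    by (auto simp: pq t'(1) perturbation_epigraph_def)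
qed

text \<open>The subgradient inequality tested at \<open>z + v\<close>, with the finite value
  \<open>g z\<close> cancelled. This sign turns cone-convexity of \<open>c\<close> into convexity of
  \<open>p \<bullet> c\<close>.\<close>

lemma inner_hzn_nonpos:
  assumes "p \<in> subdiff g z" "v \<in> hzn g" "g z \<noteq> -\<infinity>"
  shows "p \<bullet> v \<le> 0"
proof -
  have "z \<in> eff_dom g" "g z + ereal (p \<bullet> ((z + v) - z)) \<le> g (z + v)"
    using assms(1) unfolding subdiff_def by blast+
  moreover from this have "g (z + v) \<le> g z" using assms(2) by (simp add: hzn_def)
  ultimately have "z \<in> eff_dom g" "g z + ereal (p \<bullet> v) \<le> g z" by auto
  then show ?thesis using assms(3) by (cases "g z") (auto simp: eff_dom_def)
qed

lemma convex_on_lagrangian: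
  fixes f :: "'a::real_vector \<Rightarrow> real" and c :: "'a \<Rightarrow> 'b::real_inner"
  assumes f: "convex_on UNIV f" and c: "neg_hzn_convex g c"
    and p: "p \<in> subdiff g z" "g z \<noteq> -\<infinity>"
  shows "convex_on UNIV (\<lambda>x. f x + p \<bullet> c x)"
proof (rule convex_on_add[OF f convex_onI])
  fix t :: real and x y :: 'a
  assume t: "0 < t" "t < 1"
  have "c ((1 - t) *\<^sub>R x + (1 - (1 - t)) *\<^sub>R y) - (1 - t) *\<^sub>R c x - (1 - (1 - t)) *\<^sub>R c y \<in> hzn g"
    using c t unfolding neg_hzn_convex_def by (metis atLeastAtMost_iff diff_ge_0_iff_ge
        diff_le_eq le_add_same_cancel1 less_imp_le)
  from inner_hzn_nonpos[OF p(1) this p(2)]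
  show "p \<bullet> c ((1 - t) *\<^sub>R x + t *\<^sub>R y) \<le> (1 - t) * (p \<bullet> c x) + t * (p \<bullet> c y)"
    by (simp add: inner_diff_right)
qed simp

text \<open>Restriction to the line through \<open>x\<close> and \<open>w\<close> reduces this to
  the tangent inequality in one variable.\<close>

lemma convex_critical_point_minimizes:
  fixes \<phi> :: "'a::real_normed_vector \<Rightarrow> real"
  assumes conv: "convex_on UNIV \<phi>" and der: "(\<phi> has_derivative (\<lambda>h. 0)) (at x)"
  shows "\<phi> x \<le> \<phi> w"
proof -
  define \<theta> where "\<theta> = (\<lambda>t::real. \<phi> (x + t *\<^sub>R (w - x)))"
  have "convex_on UNIV \<theta>"
  proof (rule convex_onI)
    fix t a b :: real assume t: "0 < t" "t < 1"
    have "x + ((1 - t) * a + t * b) *\<^sub>R (w - x)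
        = (1 - t) *\<^sub>R (x + a *\<^sub>R (w - x)) + t *\<^sub>R (x + b *\<^sub>R (w - x))"
      by (simp add: algebra_simps)
    then show "\<theta> ((1 - t) *\<^sub>R a + t *\<^sub>R b) \<le> (1 - t) * \<theta> a + t * \<theta> b"
      unfolding \<theta>_def using convex_onD[OF conv, of t] t by simp
  qed simp
  moreover have "(\<theta> has_field_derivative 0) (at 0)"
  proof -
    have "((\<lambda>t::real. x + t *\<^sub>R (w - x)) has_derivative (\<lambda>t. t *\<^sub>R (w - x))) (at 0)"
      by (auto intro!: derivative_eq_intros)
    from has_derivative_compose[OF this, of \<phi> "\<lambda>h. 0"] der
    show ?thesis by (simp add: \<theta>_def has_field_derivative_def lambda_zero[symmetric])
  qed
  ultimately have "\<theta> 1 - \<theta> 0 \<ge> 0 * (1 - 0)"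
    by (intro convex_on_imp_above_tangent[of UNIV]) auto
  then show ?thesis by (simp add: \<theta>_def)
qed

text \<open>The adjoint of the derivative, applied to 1, represents it as an inner product;
  uniqueness of this vector justifies the description in \<open>gradient\<close>.\<close>

lemma has_derivative_gradient:
  fixes f :: "'a::euclidean_space \<Rightarrow> real"
  assumes "f differentiable at x"
  shows "(f has_derivative (\<lambda>h. h \<bullet> gradient f x)) (at x)"
proof -
  obtain f' where f': "(f has_derivative f') (at x)" using assms by (auto simp: differentiable_def)
  then have "f' h = h \<bullet> adjoint f' 1" for h
    using adjoint_works[OF has_derivative_linear, of f f' "at x" h 1] by simp
  then have "f' = (\<lambda>h. h \<bullet> adjoint f' 1)" by blast
  then have G: "GDERIV f x :> adjoint f' 1" using f' by (simp add: gderiv_def)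
  moreover have "D = adjoint f' 1" if "GDERIV f x :> D" for D
  proof -
    have "(\<lambda>h. h \<bullet> D) = (\<lambda>h. h \<bullet> adjoint f' 1)"
      using that G unfolding gderiv_def by (rule has_derivative_unique)
    then show ?thesis by (metis vector_eq_ldot)
  qed
  ultimately have "gradient f x = adjoint f' 1" unfolding gradient_def by (rule the_equality)
  then show ?thesis using G by (simp add: gderiv_def)
qed

text \<open>Identifies the vector that \<open>multipliers\<close> sets to zero as the gradient of
  the Lagrangian in \<open>x\<close>.\<close>

lemma has_derivative_lagrangian:
  fixes f :: "real ^ 'n \<Rightarrow> real" and c :: "real ^ 'n \<Rightarrow> real ^ 'm"
  assumes "f differentiable at x" "c differentiable at x"
  shows "((\<lambda>x. f x + p \<bullet> c x) has_derivative
    (\<lambda>h. h \<bullet> (gradient f x + transpose (jacobian c (at x)) *v p))) (at x)"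
proof -
  have "((\<lambda>x. f x + p \<bullet> c x) has_derivative
      (\<lambda>h. h \<bullet> gradient f x + p \<bullet> (jacobian c (at x) *v h))) (at x)"
    using has_derivative_gradient[OF assms(1)] assms(2)[unfolded jacobian_works]
    by (intro has_derivative_add has_derivative_inner_right)
  then show ?thesis
    by (simp add: dot_lmul_matrix inner_add_right inner_commute[of _ "p v* _"])
qed

lemma cont_differentiable_imp_differentiable:
  "cont_differentiable h \<Longrightarrow> h differentiable at x"
  by (auto simp: cont_differentiable_def differentiable_def)

text \<open>A multiplier makes \<open>x\<close> a critical point, hence a minimizer, of the convex
  Lagrangian; adding the subgradient inequality gives support. For minimizers the right-hand side
  depends only on the optimal value, which is why they share their multipliers.\<close>

lemma multipliers_eq_support_slopes:
  fixes f :: "real ^ 'n \<Rightarrow> real" and c :: "real ^ 'n \<Rightarrow> real ^ 'm"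
  assumes f: "cont_differentiable f" "convex_on UNIV f"
    and g: "proper_fun g"
    and c: "cont_differentiable c" "neg_hzn_convex g c"
    and val: "g (c x) = ereal r"
  shows "multipliers f g c x = support_slopes (perturbation_epigraph f g c) (f x + r)"
proof -
  note deriv = has_derivative_lagrangian[OF cont_differentiable_imp_differentiable[OF f(1)]
      cont_differentiable_imp_differentiable[OF c(1)]]
  have fin: "g w \<noteq> -\<infinity>" for w using g by (simp add: proper_fun_def)
  have "f x + r + p \<bullet> u \<le> s"
    if p: "p \<in> multipliers f g c x" and us: "(u, s) \<in> perturbation_epigraph f g c" for p u s
  proof -
    have sub: "p \<in> subdiff g (c x)" using p by (simp add: multipliers_def)
    have "((\<lambda>x. f x + p \<bullet> c x) has_derivative (\<lambda>h. 0)) (at x)"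
      using deriv[where x = x and p = p] p by (simp add: multipliers_def)
    from convex_critical_point_minimizes[OF convex_on_lagrangian[OF f(2) c(2) sub fin] this]
    have min: "f x + p \<bullet> c x \<le> f w + p \<bullet> c w" for w .
    obtain w where "g (c w + u) \<le> ereal (s - f w)" using us by (auto simp: perturbation_epigraph_def)
    moreover have "ereal r + ereal (p \<bullet> (c w + u - c x)) \<le> g (c w + u)"
      using sub unfolding subdiff_def val[symmetric] by blast
    ultimately have "ereal r + ereal (p \<bullet> (c w + u - c x)) \<le> ereal (s - f w)" by (rule order_trans[rotated])
    then show ?thesis using min[of w] by (simp add: inner_simps)
  qed
  moreover have "p \<in> multipliers f g c x"
    if p: "p \<in> support_slopes (perturbation_epigraph f g c) (f x + r)" for p
  proof -
    have le: "f x + r + p \<bullet> u \<le> s" if "g (c w + u) \<le> ereal (s - f w)" for w u s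
      using p that by (auto simp: support_slopes_def perturbation_epigraph_def)
    have "ereal r + ereal (p \<bullet> (w - c x)) \<le> g w" for w
    proof (cases "g w")
      case (real t)
      \<comment> \<open>Keeping the point \<open>x\<close> fixed and varying only the perturbation
        isolates the subgradient inequality.\<close>
      then show ?thesis using le[where w = x and u = "w - c x" and s = "t + f x"] by simp
    qed (use fin in auto)
    then have "p \<in> subdiff g (c x)" by (simp add: subdiff_def eff_dom_def val)
    moreover have "f x + p \<bullet> c x \<le> f w + p \<bullet> c w" for w
      \<comment> \<open>This perturbation moves the argument of \<open>g\<close> back to
        \<open>c x\<close>, so only the Lagrangian varies with \<open>w\<close>.\<close>
      using le[where w = w and u = "c x - c w" and s = "f w + r"] by (simp add: val inner_diff_right)
    then have "(\<lambda>h. h \<bullet> (gradient f x + transpose (jacobian c (at x)) *v p)) = (\<lambda>h. 0)"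
      by (intro has_derivative_local_min[OF deriv]) simp
    then have "gradient f x + transpose (jacobian c (at x)) *v p = 0"
      by (metis inner_eq_zero_iff)
    ultimately show ?thesis by (simp add: multipliers_def)
  qed
  ultimately show ?thesis by (auto simp: support_slopes_def)
qed

section \<open>The augmented Lagrangian expressed through perturbations\<close>

lemma shifted_quadratic:
  fixes u y :: "'a::real_inner"
  assumes "\<mu> > 0"
  shows "1 / (2 * \<mu>) * (norm (u - \<mu> *\<^sub>R y))\<^sup>2 - \<mu> / 2 * (norm y)\<^sup>2 = (norm u)\<^sup>2 / (2 * \<mu>) - u \<bullet> y"
  using assms by (simp add: power2_norm_eq_inner inner_simps inner_commute field_simps)

text \<open>The witness \<open>x\<close> of membership is tested in the outer infimum and
  \<open>c x + u\<close> in the Moreau envelope.\<close>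

lemma Inf_aug_lagrangian_le:
  assumes \<mu>: "\<mu> > 0" and us: "(u, s) \<in> perturbation_epigraph f g c"
  shows "(INF x. aug_lagrangian f g c \<mu> x y) \<le> ereal (s - u \<bullet> y + (norm u)\<^sup>2 / (2 * \<mu>))"
proof -
  obtain x where x: "g (c x + u) \<le> ereal (s - f x)" using us by (auto simp: perturbation_epigraph_def)
  have "moreau_env \<mu> g (c x + \<mu> *\<^sub>R y) \<le> g (c x + u) + ereal (1 / (2 * \<mu>) * (norm (u - \<mu> *\<^sub>R y))\<^sup>2)"
    unfolding moreau_env_def by (rule INF_lower2[of "c x + u"]) auto
  also have "\<dots> \<le> ereal (s - f x) + ereal (1 / (2 * \<mu>) * (norm (u - \<mu> *\<^sub>R y))\<^sup>2)"
    by (rule add_right_mono[OF x])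
  finally have "aug_lagrangian f g c \<mu> x y \<le> ereal (f x)
      + ereal (s - f x + 1 / (2 * \<mu>) * (norm (u - \<mu> *\<^sub>R y))\<^sup>2) - ereal (\<mu> / 2 * (norm y)\<^sup>2)"
    unfolding aug_lagrangian_def by (intro ereal_minus_mono add_left_mono) auto
  also have "\<dots> = ereal (s - u \<bullet> y + (norm u)\<^sup>2 / (2 * \<mu>))"
    using shifted_quadratic[OF \<mu>, of u y] by simp
  finally show ?thesis by (intro INF_lower2[of x]) auto
qed

text \<open>By \<open>min\<close>, the Moreau envelope is attained at \<open>z\<close>, which
  corresponds to the perturbation \<open>z - c x\<close>.\<close>

lemma aug_lagrangian_eq:
  assumes \<mu>: "\<mu> > 0" and val: "g z = ereal r"
    and min: "\<And>w. g z + ereal (1 / (2 * \<mu>) * (norm (z - (c x + \<mu> *\<^sub>R y)))\<^sup>2)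
      \<le> g w + ereal (1 / (2 * \<mu>) * (norm (w - (c x + \<mu> *\<^sub>R y)))\<^sup>2)"
  shows "aug_lagrangian f g c \<mu> x y
    = ereal (f x + r - (z - c x) \<bullet> y + (norm (z - c x))\<^sup>2 / (2 * \<mu>))"
proof -
  have "moreau_env \<mu> g (c x + \<mu> *\<^sub>R y) = g z + ereal (1 / (2 * \<mu>) * (norm (z - (c x + \<mu> *\<^sub>R y)))\<^sup>2)"
    unfolding moreau_env_def using min by (intro antisym INF_lower INF_greatest) auto
  also have "\<dots> = ereal (r + 1 / (2 * \<mu>) * (norm ((z - c x) - \<mu> *\<^sub>R y))\<^sup>2)"
    by (simp add: val diff_diff_eq)
  finally show ?thesis
    using shifted_quadratic[OF \<mu>, of "z - c x" y] by (simp add: aug_lagrangian_def)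
qed

section \<open>Convergence of the augmented Lagrangian method\<close>

theorem theorem4p5:
  fixes f :: "real ^ 'n \<Rightarrow> real"
    and g :: "real ^ 'm \<Rightarrow> ereal"
    and c :: "real ^ 'n \<Rightarrow> real ^ 'm"
    and \<beta> :: real
    and \<epsilon> \<mu> :: "nat \<Rightarrow> real"
    and x :: "nat \<Rightarrow> real ^ 'n"
    and z y :: "nat \<Rightarrow> real ^ 'm"
  assumes f: "cont_differentiable f" "convex_on UNIV f"
    and g: "proper_fun g" "lsc_fun g" "convex_fun g"
    and c: "cont_differentiable c" "neg_hzn_convex g c"
    and P: "\<exists>x. feasible g c x" "\<exists>x. minimizer f g c x"
    and stat: "\<exists>x. minimizer f g c x \<and> stationary f g c x"
    and alm: "classical_ALM f g c \<beta> \<epsilon> \<mu> x z y"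
    and summ: "summable (\<lambda>k. sqrt (\<epsilon> k / \<mu> k))"
  shows "(\<exists>ystar \<in> multiplier_set f g c. y \<longlonglongrightarrow> ystar)
    \<and> (\<lambda>k. c (x k) - z k) \<longlonglongrightarrow> 0
    \<and> limsup (\<lambda>k. ereal (f (x k)) + g (z k)) \<le> min_value f g c
    \<and> (\<forall>xbar. accumulation_point x xbar \<longrightarrow> minimizer f g c xbar)
    \<and> (\<forall>(r :: nat \<Rightarrow> nat) xbar. strict_mono r \<and> (\<lambda>j. x (r j)) \<longlonglongrightarrow> xbar \<longrightarrow>
          (\<lambda>j. z (r j)) \<longlonglongrightarrow> c xbar
          \<and> (\<lambda>j. ereal (f (x (r j))) + g (z (r j))) \<longlonglongrightarrow> min_value f g c)"
proof -
  let ?S = "perturbation_epigraph f g c"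
  have fin: "g w \<noteq> -\<infinity>" for w using g(1) by (simp add: proper_fun_def)
  obtain xs p where xs: "minimizer f g c xs" and p: "p \<in> multipliers f g c xs"
    using stat by (auto simp: stationary_def)
  have "g (c xs) < \<infinity>" using xs by (simp add: minimizer_def feasible_def eff_dom_def)
  then obtain r0 where r0: "g (c xs) = ereal r0" using fin[of "c xs"] by (cases "g (c xs)") auto
  define v0 where "v0 = f xs + r0"
  have obj: "objective f g c xs = ereal v0" by (simp add: objective_def r0 v0_def)
  have mv: "min_value f g c = ereal v0"
    unfolding min_value_def obj[symmetric] using xs
    by (intro antisym INF_lower INF_greatest) (auto simp: minimizer_def)
  have minimizer_iff: "minimizer f g c w \<longleftrightarrow> g (c w) = ereal (v0 - f w)" for w
  proof
    assume w: "minimizer f g c w"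
    then have "objective f g c w = ereal v0"
      using xs obj by (metis antisym minimizer_def)
    then show "g (c w) = ereal (v0 - f w)"
      using fin[of "c w"] by (cases "g (c w)") (auto simp: objective_def)
  next
    assume "g (c w) = ereal (v0 - f w)"
    then show "minimizer f g c w"
      using xs obj by (simp add: minimizer_def feasible_def eff_dom_def objective_def)
  qed
  \<comment> \<open>With \<open>r = v0 - f w\<close> the value \<open>f w + r\<close> is
    \<open>v0\<close> for every minimizer, so \<open>multiplier_set\<close> intersects copies of one
    set.\<close>
  have "multipliers f g c w = support_slopes ?S v0" if "minimizer f g c w" for w
    using multipliers_eq_support_slopes[OF f g(1) c] that by (simp add: minimizer_iff)
  then have \<Lambda>: "multiplier_set f g c = support_slopes ?S v0" and D: "support_slopes ?S v0 \<noteq> {}"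
    using xs p by (auto simp: multiplier_set_def)
  have S0: "(0, v0) \<in> ?S" by (auto simp: perturbation_epigraph_def v0_def r0 intro!: exI[of _ xs])
  \<comment> \<open>The multiplier at \<open>xs\<close> is a subgradient and provides the affine
    minorant for \<open>prox_minimizes\<close>.\<close>
  have minor: "ereal (p \<bullet> w + (r0 - p \<bullet> c xs)) \<le> g w" for w
  proof -
    have "g (c xs) + ereal (p \<bullet> (w - c xs)) \<le> g w"
      using p by (simp add: multipliers_def subdiff_def)
    then show ?thesis by (simp add: r0 inner_diff_right algebra_simps)
  qed

  have \<mu>0: "\<mu> 0 > 0" and \<beta>: "0 < \<beta>" "\<beta> < 1" and e: "\<And>k. 0 \<le> \<epsilon> k"
    and xk: "\<And>k. aug_lagrangian f g c (\<mu> k) (x k) (y k)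
      \<le> (INF x'. aug_lagrangian f g c (\<mu> k) x' (y k)) + ereal (\<epsilon> k)"
    and zk: "\<And>k. z k = prox (\<lambda>w. ereal (\<mu> k) * g w) (c (x k) + \<mu> k *\<^sub>R y k)"
    and yk: "\<And>k. y (Suc k) = y k + (1 / \<mu> k) *\<^sub>R (c (x k) - z k)"
    and \<mu>k: "\<And>k. \<exists>b\<in>{0<..\<beta>} \<union> {1}. \<mu> (Suc k) = b * \<mu> k"
    using alm unfolding classical_ALM_def by blast+
  \<comment> \<open>All factors lie in \<open>(0, 1]\<close>, so \<open>\<mu> 0\<close> can serve as
    the bound \<open>B\<close>.\<close>
  have \<mu>: "0 < \<mu> k \<and> \<mu> k \<le> \<mu> 0" for k
  proof (induction k)
    case (Suc k)
    obtain b where b: "b \<in> {0<..\<beta>} \<union> {1}" "\<mu> (Suc k) = b * \<mu> k" using \<mu>k by blast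
    then have b': "0 < b" "b \<le> 1" using \<beta> by auto
    then have "\<mu> (Suc k) \<le> 1 * \<mu> k" unfolding b(2) using Suc by (intro mult_right_mono) auto
    then have "\<mu> (Suc k) \<le> \<mu> 0" using Suc by linarith
    then show ?case using b(2) b'(1) Suc by simp
  qed (simp add: \<mu>0)
  have pos: "0 < \<mu> k" for k using \<mu> by blast
  note prox = prox_minimizes[OF g minor pos]
  have "\<bar>g (z k)\<bar> \<noteq> \<infinity>" for k unfolding zk by (rule prox(1))
  then have "\<forall>k. \<exists>r. g (z k) = ereal r" by (metis ereal_real')
  then obtain gz where gz: "\<And>k. g (z k) = ereal (gz k)" by metis
  define u where "u = (\<lambda>k. z k - c (x k))"
  define s where "s = (\<lambda>k. f (x k) + gz k)"
  have us: "(u k, s k) \<in> ?S" for k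
    by (auto simp: perturbation_epigraph_def u_def s_def gz intro!: exI[of _ "x k"])
  \<comment> \<open>Approximate minimality in \<open>x\<close> transfers to \<open>S\<close>: the
    left side equals the augmented Lagrangian at \<open>x k\<close>, while every point of
    \<open>S\<close> bounds its infimum from above.\<close>
  have near: "s k - u k \<bullet> y k + (norm (u k))\<^sup>2 / (2 * \<mu> k)
      \<le> s' - u' \<bullet> y k + (norm u')\<^sup>2 / (2 * \<mu> k) + \<epsilon> k" if "(u', s') \<in> ?S" for k u' s'
  proof -
    have "ereal (s k - u k \<bullet> y k + (norm (u k))\<^sup>2 / (2 * \<mu> k)) = aug_lagrangian f g c (\<mu> k) (x k) (y k)"
      unfolding u_def s_def
      by (rule aug_lagrangian_eq[where g = g and z = "z k", OF pos gz, symmetric]) (unfold zk, rule prox(2))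
    also have "\<dots> \<le> ereal (s' - u' \<bullet> y k + (norm u')\<^sup>2 / (2 * \<mu> k)) + ereal (\<epsilon> k)"
      by (rule order_trans[OF xk add_right_mono[OF Inf_aug_lagrangian_le[OF pos that]]])
    finally show ?thesis by simp
  qed
  have y_step: "y (Suc k) = y k - (1 / \<mu> k) *\<^sub>R u k" for k
    by (simp add: yk u_def algebra_simps)
  note conv = inexact_dual_proximal_point[OF convex_perturbation_epigraph[OF f(2) g(3) c(2)] S0 D
      pos conjunct2[OF \<mu>] e summ us near y_step]
  have u0: "u \<longlonglongrightarrow> 0" and s0: "s \<longlonglongrightarrow> v0" using conv by blast+
  have s_eq: "ereal (f (x k)) + g (z k) = ereal (s k)" for k by (simp add: s_def gz)
  have cont: "isCont f w" "isCont c w" for w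
    using f(1) c(1) cont_differentiable_imp_differentiable differentiable_imp_continuous_within
    by blast+
  have zr: "(\<lambda>j. z (r j)) \<longlonglongrightarrow> c xbar" and sr: "(\<lambda>j. s (r j)) \<longlonglongrightarrow> v0"
    if r: "strict_mono r" and xr: "(\<lambda>j. x (r j)) \<longlonglongrightarrow> xbar" for r :: "nat \<Rightarrow> nat" and xbar
  proof -
    have "(\<lambda>j. u (r j) + c (x (r j))) \<longlonglongrightarrow> 0 + c xbar"
      using LIMSEQ_subseq_LIMSEQ[OF u0 r] isCont_tendsto_compose[OF cont(2) xr]
      by (intro tendsto_add) (simp_all add: o_def)
    then show "(\<lambda>j. z (r j)) \<longlonglongrightarrow> c xbar" by (simp add: u_def)
    show "(\<lambda>j. s (r j)) \<longlonglongrightarrow> v0" using LIMSEQ_subseq_LIMSEQ[OF s0 r] by (simp add: o_def)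
  qed
  have "minimizer f g c xbar" if acc: "accumulation_point x xbar" for xbar
  proof -
    obtain r where r: "strict_mono (r :: nat \<Rightarrow> nat)" and xr: "(\<lambda>j. x (r j)) \<longlonglongrightarrow> xbar"
      using acc by (auto simp: accumulation_point_def o_def)
    have "(\<lambda>j. s (r j) - f (x (r j))) \<longlonglongrightarrow> v0 - f xbar"
      by (intro tendsto_diff sr[OF r xr] isCont_tendsto_compose[OF cont(1) xr])
    \<comment> \<open>Lower semicontinuity yields one inequality for the value at
      \<open>xbar\<close>; the other is optimality of \<open>xs\<close>.\<close>
    from lsc_fun_sequential[OF g(2) zr[OF r xr] this]
    have "g (c xbar) \<le> ereal (v0 - f xbar)" by (simp add: s_def gz)
    moreover have "ereal v0 \<le> ereal (f xbar) + g (c xbar)"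
      using xs obj by (metis minimizer_def objective_def)
    ultimately show ?thesis
      unfolding minimizer_iff using fin[of "c xbar"] by (cases "g (c xbar)") auto
  qed
  moreover have "(\<lambda>k. c (x k) - z k) \<longlonglongrightarrow> 0"
    using tendsto_minus[OF u0] by (simp add: u_def)
  moreover have "limsup (\<lambda>k. ereal (f (x k)) + g (z k)) \<le> min_value f g c"
    unfolding s_eq mv using s0 by (intro eq_refl lim_imp_Limsup) auto
  moreover have "\<exists>ystar \<in> multiplier_set f g c. y \<longlonglongrightarrow> ystar" unfolding \<Lambda> by (rule conv(1))
  ultimately show ?thesis unfolding s_eq mv lim_ereal using zr sr by blast
qed

end
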